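(* Let $(\alpha, c_\alpha, n_\alpha)$ be any one of the following triples: $$\left(\tfrac13,\,4,\,13\right),\quad \left(\tfrac15,\,30,\,87\right),\quad \left(\tfrac17,\,116,\,261\right),\quad \left(\tfrac19,\,316,\,166018\right),\quad \left(\tfrac1{11},\,699,\,751307\right).$$ Then $$N_\alpha(n)\le c_\alpha+\frac{1+\alpha}{2\alpha}\,n\qquad\text{for all integers } n\ge n_\alpha.$$
   Context: For $\alpha\in(0,1)$ and a positive integer $n$, $N_\alpha(n)$ denotes the maximum number of lines through the origin in $\mathbb{R}^n$ such that the angle between any pair of distinct lines is $\arccos\alpha$. Equivalently, it is the maximum size of a set of unit vectors in $\mathbb{R}^n$ in which any two distinct vectors have inner product $\alpha$ or $-\alpha$. *)

theory Defs
  imports "HOL-Analysis.Analysis"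
begin

definition vec_angle :: "'a::real_inner \<Rightarrow> 'a \<Rightarrow> real" where
  "vec_angle x y = arccos (inner x y / (norm x * norm y))"

definition origin_line :: "'a::euclidean_space set \<Rightarrow> bool" where
  "origin_line L \<longleftrightarrow> subspace L \<and> dim L = 1"

(* Direction vectors are only determined up to sign; the angle between two lines is the
   smaller of the two resulting angles, hence lies in [0, pi/2]. *)
definition line_angle :: "'a::euclidean_space set \<Rightarrow> 'a set \<Rightarrow> real" where
  "line_angle L M = Inf {vec_angle x y | x y. x \<in> L - {0} \<and> y \<in> M - {0}}"

definition equiangular :: "real \<Rightarrow> 'a::euclidean_space set set \<Rightarrow> bool" where
  "equiangular \<alpha> S \<longleftrightarrow> (\<forall>L\<in>S. origin_line L) \<and>
     (\<forall>L\<in>S. \<forall>M\<in>S. L \<noteq> M \<longrightarrow> line_angle L M = arccos \<alpha>)"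

(* The dimension n is the cardinality of the index type 'n. For 0 < \<alpha> < 1 equiangular sets are
   finite and of bounded size (equiangular_bound below), so the Max is genuine (max_lines_greatest). *)
definition max_lines :: "real \<Rightarrow> 'n::finite itself \<Rightarrow> nat" where
  "max_lines \<alpha> _ = Max {card S | S :: (real ^ 'n) set set. equiangular \<alpha> S}"

lemma origin_line_unit:
  assumes "origin_line L"
  obtains u where "norm u = 1" "L = span {u}"
proof -
  obtain B where B: "B \<subseteq> L" "independent B" "L \<subseteq> span B" "card B = dim L"
    using basis_exists by blast
  have "card B = 1" using B(4) assms by (simp add: origin_line_def)
  then obtain b where b: "B = {b}" by (meson card_1_singletonE)
  have nz: "b \<noteq> 0" using B(2) dependent_zero[of B] unfolding b by blast
  have L: "L = span {b}"
    using B(1,3) assms span_minimal[of B L] unfolding b origin_line_def by blast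
  have "span {b} = span {b /\<^sub>R norm b}"
  proof -
    have "norm b *\<^sub>R (b /\<^sub>R norm b) \<in> span {b /\<^sub>R norm b}"
      by (intro span_scale span_base) simp
    then have "b \<in> span {b /\<^sub>R norm b}" using nz by simp
    moreover have "b /\<^sub>R norm b \<in> span {b}" by (simp add: span_base span_scale)
    ultimately show ?thesis by (simp add: span_eq)
  qed
  then show thesis using that[of "b /\<^sub>R norm b"] L nz by auto
qed

lemma line_angle_span:
  assumes u: "norm u = 1" and v: "norm v = 1"
  shows "line_angle (span {u}) (span {v}) = arccos \<bar>inner u v\<bar>"
proof -
  let ?t = "inner u v"
  have t: "\<bar>?t\<bar> \<le> 1" using Cauchy_Schwarz_ineq2[of u v] u v by simp
  let ?A = "{vec_angle x y | x y. x \<in> span {u} - {0} \<and> y \<in> span {v} - {0}}"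
  have nz: "u \<noteq> 0" "v \<noteq> 0" using u v by auto
  have 1: "arccos \<bar>?t\<bar> \<le> z" if zA: "z \<in> ?A" for z
  proof -
    obtain x y where z: "z = vec_angle x y" and x: "x \<in> span {u}" and y: "y \<in> span {v}"
      and n: "x \<noteq> 0" "y \<noteq> 0" using zA by blast
    obtain a b where ab: "x = a *\<^sub>R u" "y = b *\<^sub>R v" using x y by (auto simp: span_singleton)
    have n: "a \<noteq> 0" "b \<noteq> 0" using n ab by auto
    have "\<bar>inner x y / (norm x * norm y)\<bar> = \<bar>?t\<bar>"
      using n u v by (simp add: ab abs_mult)
    then have "inner x y / (norm x * norm y) \<le> \<bar>?t\<bar>" "-1 \<le> inner x y / (norm x * norm y)"
      using t by linarith+
    then show ?thesis unfolding z vec_angle_def using t by (intro arccos_le_arccos) auto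
  qed
  have 2: "arccos \<bar>?t\<bar> \<in> ?A"
  proof (cases "?t \<ge> 0")
    case True
    then have "arccos \<bar>?t\<bar> = vec_angle u v" using u v by (simp add: vec_angle_def)
    moreover have "u \<in> span {u} - {0}" "v \<in> span {v} - {0}"
      using nz by (simp_all add: span_base)
    ultimately show ?thesis by blast
  next
    case False
    then have "arccos \<bar>?t\<bar> = vec_angle u (- v)" using u v by (simp add: vec_angle_def)
    moreover have "u \<in> span {u} - {0}" "- v \<in> span {v} - {0}"
      using nz by (simp_all add: span_base span_neg)
    ultimately show ?thesis by blast
  qed
  show ?thesis unfolding line_angle_def
    using 1 2 by (intro cInf_eq_minimum) auto
qed

lemma equiangular_units:
  fixes S :: "'a::euclidean_space set set"
  assumes S: "equiangular \<alpha> S" and \<alpha>: "0 < \<alpha>" "\<alpha> < 1"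
  obtains u where "\<And>L. L \<in> S \<Longrightarrow> norm (u L) = 1" "\<And>L. L \<in> S \<Longrightarrow> span {u L} = L"
    "\<And>L M. L \<in> S \<Longrightarrow> M \<in> S \<Longrightarrow> L \<noteq> M \<Longrightarrow> \<bar>inner (u L) (u M)\<bar> = \<alpha>"
proof -
  have "\<forall>L\<in>S. \<exists>u. norm u = 1 \<and> L = span {u}"
    using S origin_line_unit unfolding equiangular_def by metis
  then obtain u where u': "\<forall>L\<in>S. norm (u L) = 1 \<and> L = span {u L}"
    by (rule bchoice[THEN exE])
  have u: "norm (u L) = 1" "span {u L} = L" if "L \<in> S" for L using u' that by blast+
  have "\<bar>inner (u L) (u M)\<bar> = \<alpha>" if LM: "L \<in> S" "M \<in> S" "L \<noteq> M" for L M
  proof -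
    have "arccos \<bar>inner (u L) (u M)\<bar> = arccos \<alpha>"
      using S LM line_angle_span[of "u L" "u M"] by (simp add: equiangular_def u)
    moreover have "\<bar>inner (u L) (u M)\<bar> \<le> 1"
      using Cauchy_Schwarz_ineq2[of "u L" "u M"] u LM by simp
    ultimately show ?thesis using \<alpha> by (subst (asm) arccos_eq_iff) auto
  qed
  from u this show thesis by (rule that)
qed

lemma equiangular_bound_finite:
  fixes S :: "(real ^ 'n::finite) set set"
  assumes S: "equiangular \<alpha> S" and \<alpha>: "0 < \<alpha>" "\<alpha> < 1" and F: "F \<subseteq> S" "finite F"
  shows "card F \<le> CARD('n) * CARD('n)"
proof -
  obtain u :: "(real ^ 'n) set \<Rightarrow> real ^ 'n"
    where u: "\<And>L. L \<in> S \<Longrightarrow> norm (u L) = 1"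
    "\<And>L M. L \<in> S \<Longrightarrow> M \<in> S \<Longrightarrow> L \<noteq> M \<Longrightarrow> \<bar>inner (u L) (u M)\<bar> = \<alpha>"
    using equiangular_units[OF S \<alpha>] by metis
  define A :: "(real ^ 'n) set \<Rightarrow> real ^ 'n ^ 'n" where "A = (\<lambda>L. \<chi> i j. u L $ i * u L $ j)"
  have inn: "inner (A L) (A M) = (inner (u L) (u M))\<^sup>2" for L M
    by (simp add: A_def inner_vec_def power2_eq_square sum_product algebra_simps)
  have diag: "inner (A L) (A L) = 1" if "L \<in> F" for L
    unfolding inn using u(1)[of L] that F by (simp add: dot_square_norm subset_iff)
  have off: "inner (A L) (A M) = \<alpha>\<^sup>2" if "L \<in> F" "M \<in> F" "L \<noteq> M" for L M
  proof -
    have "\<bar>inner (u L) (u M)\<bar> = \<alpha>" using u(2)[of L M] that F by blast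
    then show ?thesis unfolding inn using power2_abs[of "inner (u L) (u M)"] by simp
  qed
  have a1: "\<alpha>\<^sup>2 < 1" using \<alpha> by (simp add: power_less_one_iff)
  have inj: "inj_on A F"
  proof (rule inj_onI, rule ccontr)
    fix L M assume "L \<in> F" "M \<in> F" "A L = A M" "L \<noteq> M"
    then show False using diag[of L] off[of L M] a1 by simp
  qed
  have "independent (A ` F)"
  proof (rule independent_if_scalars_zero)
    show "finite (A ` F)" using F by simp
    fix f x assume f: "(\<Sum>x\<in>A ` F. f x *\<^sub>R x) = 0" and x: "x \<in> A ` F"
    define c where "c = (\<lambda>L. f (A L))"
    define s where "s = (\<Sum>L\<in>F. c L)"
    have 0: "(\<Sum>L\<in>F. c L *\<^sub>R A L) = 0" using f by (simp add: sum.reindex[OF inj] c_def)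
    have e: "c M * (1 - \<alpha>\<^sup>2) = - \<alpha>\<^sup>2 * s" if M: "M \<in> F" for M
    proof -
      have "0 = inner (\<Sum>L\<in>F. c L *\<^sub>R A L) (A M)" using 0 by simp
      also have "\<dots> = (\<Sum>L\<in>F. c L * inner (A L) (A M))" by (simp add: inner_sum_left)
      also have "\<dots> = (\<Sum>L\<in>F. \<alpha>\<^sup>2 * c L + (if L = M then c M * (1 - \<alpha>\<^sup>2) else 0))"
        using M by (intro sum.cong) (auto simp: diag off algebra_simps)
      also have "\<dots> = \<alpha>\<^sup>2 * s + c M * (1 - \<alpha>\<^sup>2)"
        using M F by (simp add: sum.distrib s_def sum_distrib_left)
      finally show ?thesis by simp
    qed
    have "s * (1 - \<alpha>\<^sup>2) = (\<Sum>M\<in>F. - \<alpha>\<^sup>2 * s)"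
      unfolding s_def sum_distrib_right using e by (intro sum.cong) (auto simp: s_def)
    then have "s * (1 - \<alpha>\<^sup>2 + real (card F) * \<alpha>\<^sup>2) = 0" by (simp add: algebra_simps)
    moreover have "1 - \<alpha>\<^sup>2 + real (card F) * \<alpha>\<^sup>2 > 0"
      using a1 by (intro add_pos_nonneg) auto
    ultimately have "s = 0" by simp
    then have "c M = 0" if "M \<in> F" for M using e[OF that] a1 by auto
    then show "f x = 0" using x by (auto simp: c_def)
  qed
  then have "card (A ` F) \<le> DIM(real ^ 'n ^ 'n)" using independent_bound by blast
  then show ?thesis by (simp add: card_image[OF inj])
qed

lemma equiangular_bound:
  fixes S :: "(real ^ 'n::finite) set set"
  assumes "equiangular \<alpha> S" "0 < \<alpha>" "\<alpha> < 1"
  shows "finite S" "card S \<le> CARD('n) * CARD('n)"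
proof -
  show fin: "finite S"
  proof (rule ccontr)
    assume "infinite S"
    then obtain F where "finite F" "card F = Suc (CARD('n) * CARD('n))" "F \<subseteq> S"
      using infinite_arbitrarily_large by blast
    then show False using equiangular_bound_finite[OF assms, of F] by simp
  qed
  show "card S \<le> CARD('n) * CARD('n)"
    by (rule equiangular_bound_finite[OF assms subset_refl fin])
qed

lemma max_lines_greatest:
  assumes "0 < \<alpha>" "\<alpha> < 1"
  shows "\<exists>S :: (real ^ 'n::finite) set set. equiangular \<alpha> S \<and> card S = max_lines \<alpha> TYPE('n)"
    and "equiangular \<alpha> (S :: (real ^ 'n) set set) \<Longrightarrow> card S \<le> max_lines \<alpha> TYPE('n)"
proof -
  let ?C = "{card S | S :: (real ^ 'n) set set. equiangular \<alpha> S}"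
  have fin: "finite ?C"
    by (rule finite_subset[of _ "{..CARD('n) * CARD('n)}"]) (use equiangular_bound(2) assms in auto)
  have "card ({} :: (real ^ 'n) set set) \<in> ?C" unfolding equiangular_def by blast
  then have "Max ?C \<in> ?C" using fin by (intro Max_in) blast+
  then show "\<exists>S :: (real ^ 'n) set set. equiangular \<alpha> S \<and> card S = max_lines \<alpha> TYPE('n)"
    unfolding max_lines_def by force
  show "equiangular \<alpha> (S :: (real ^ 'n) set set) \<Longrightarrow> card S \<le> max_lines \<alpha> TYPE('n)"
    unfolding max_lines_def by (intro Max_ge fin) blast
qed

end

theory Submission
  imports Defs
begin

text \<open>
Choose unit vectors \<open>v i\<close> on \<open>N\<close> equiangular lines in dimension \<open>n\<close> and let \<open>T\<close> be the operator
\<open>\<Sum>i. v i (v i)\<^sup>T\<close>, which has the same nonzero eigenvalues as the Gram matrix. Its trace is \<open>N\<close> and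
the trace of its square is \<open>N D\<close> with \<open>D = 1 - \<alpha>\<^sup>2 + \<alpha>\<^sup>2 N\<close>, so its top eigenvalue \<open>\<mu>\<close> is at least \<open>D\<close>.
The slope \<open>(1 + \<alpha>) / (2 \<alpha>)\<close> appears because, for large \<open>N\<close>, every other eigenvalue is at most
about \<open>(1 - \<alpha>\<^sup>2) / (2 \<alpha>)\<close>, while \<open>\<mu> \<le> 1 + \<alpha> (N - 1)\<close> leaves a trace of at least \<open>(1 - \<alpha>) (N - 1)\<close>
to the other \<open>n - 1\<close> eigenvalues.

The control over the other eigenvalues comes from the space of symmetric matrices. There the
projections \<open>v i (v i)\<^sup>T\<close> have constant inner product \<open>\<alpha>\<^sup>2\<close>, so the norm of the orthogonal projection
of any matrix to their span is explicit (\<open>bessel_equal_inner\<close>), and it is at most the norm of the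
matrix. Let \<open>x\<close> be a unit top eigenvector. The symmetrized product of \<open>x\<close> and \<open>v l\<close> gives a lower bound
on \<open>(x \<bullet> v l)\<^sup>2\<close> for each single \<open>l\<close>: the top eigenvector of the Gram matrix is flat. The
symmetrized product of \<open>x\<close> and any \<open>w\<close> orthogonal to \<open>x\<close> gives an upper bound on
\<open>\<Sum>i. (x \<bullet> v i)\<^sup>2 (w \<bullet> v i)\<^sup>2\<close>, which by flatness is an upper bound on \<open>w \<bullet> T w\<close>. Taking the trace
over the complement of \<open>x\<close> gives \<open>spectral_inequality\<close>.

These steps need \<open>D > s\<close> for \<open>s = (1 - \<alpha>\<^sup>2) / (2 \<alpha>\<^sup>2)\<close>. With \<open>a = 1 / \<alpha>\<close> this says
\<open>N > (a\<^sup>2 - 1) (a\<^sup>2 - 2) / 2\<close>, where the right-hand side is 28, 276, 1128, 3160, 7140 for the five angles; at most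
that many lines satisfy the claim because \<open>n\<close> is large. For more lines, the difference of the two
sides of the inequality is concave in \<open>\<mu>\<close>, so that only the two ends of the range
\<open>D \<le> \<mu> \<le> 1 + \<alpha> (N - 1)\<close> matter (\<open>spectral_inequality_at_endpoint\<close>). The upper end decides and yields a quadratic
inequality for \<open>N\<close> alone, which fails for the given constants.
\<close>

section \<open>Bessel's inequality for symmetric matrices\<close>

definition sym_outer :: "real ^ 'n::finite \<Rightarrow> real ^ 'n \<Rightarrow> real ^ 'n ^ 'n" where
  "sym_outer a b = (\<chi> i j. (a $ i * b $ j + b $ i * a $ j) / 2)"

lemma inner_sym_outer:
  "inner (sym_outer a b) (sym_outer c d) =
     (inner a c * inner b d + inner a d * inner b c) / 2"
proof -
  have "inner (sym_outer a b) (sym_outer c d) =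
      (\<Sum>i\<in>UNIV. \<Sum>j\<in>UNIV. ((a $ i * c $ i) * (b $ j * d $ j) + (a $ i * d $ i) * (b $ j * c $ j)
        + (b $ i * c $ i) * (a $ j * d $ j) + (b $ i * d $ i) * (a $ j * c $ j)) / 4)"
    by (simp add: sym_outer_def inner_vec_def field_simps)
  also have "\<dots> = (inner a c * inner b d + inner a d * inner b c
      + inner b c * inner a d + inner b d * inner a c) / 4"
    by (simp add: inner_vec_def sum_product sum.distrib flip: sum_divide_distrib)
  finally show ?thesis by (simp add: field_simps)
qed

text \<open>
The difference of the two sides is \<open>1 - \<beta>\<close> times the squared distance from \<open>X\<close> to the span of the \<open>V i\<close>.
The Gram matrix \<open>(1 - \<beta>) 1 + \<beta> J\<close> has an explicit inverse, and applying it to \<open>(X \<bullet> V i)\<^sub>i\<close> gives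
the coefficients \<open>c i\<close> of the orthogonal projection \<open>Y\<close>.
\<close>

lemma bessel_equal_inner:
  fixes V :: "'i \<Rightarrow> 'b::real_inner" and X :: 'b and \<beta> :: real
  assumes fin: "finite I" and \<beta>: "0 \<le> \<beta>" "\<beta> < 1"
    and diag: "\<And>i. i \<in> I \<Longrightarrow> inner (V i) (V i) = 1"
    and off: "\<And>i j. i \<in> I \<Longrightarrow> j \<in> I \<Longrightarrow> i \<noteq> j \<Longrightarrow> inner (V i) (V j) = \<beta>"
  shows "(\<Sum>i\<in>I. (inner X (V i))\<^sup>2)
      - \<beta> / (1 - \<beta> + \<beta> * card I) * (\<Sum>i\<in>I. inner X (V i))\<^sup>2 \<le> (1 - \<beta>) * inner X X"
proof -
  define D where "D = 1 - \<beta> + \<beta> * card I"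
  define q where "q = (\<lambda>i. inner X (V i))"
  define C where "C = (\<Sum>i\<in>I. q i) / D"
  define c where "c = (\<lambda>i. (q i - \<beta> * C) / (1 - \<beta>))"
  have D: "D > 0" unfolding D_def using \<beta> by (intro add_pos_nonneg) auto
  have q: "q i = (1 - \<beta>) * c i + \<beta> * C" for i using \<beta> by (simp add: c_def)
  have Q: "(\<Sum>i\<in>I. q i) = D * C" using D by (simp add: C_def)
  have "(1 - \<beta>) * (\<Sum>i\<in>I. c i) = (\<Sum>i\<in>I. q i - \<beta> * C)"
    unfolding sum_distrib_left by (intro sum.cong refl) (simp add: q)
  also have "\<dots> = (1 - \<beta>) * C" by (simp add: sum_subtractf Q D_def algebra_simps)
  finally have sc: "(\<Sum>i\<in>I. c i) = C" using \<beta> by simp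
  define Y where "Y = (\<Sum>i\<in>I. c i *\<^sub>R V i)"
  have VY: "inner Y (V i) = q i" if i: "i \<in> I" for i
  proof -
    have "inner Y (V i) = (\<Sum>j\<in>I. c j * inner (V j) (V i))"
      by (simp add: Y_def inner_sum_left)
    also have "\<dots> = (\<Sum>j\<in>I. \<beta> * c j + (if j = i then (1 - \<beta>) * c i else 0))"
      using i by (intro sum.cong) (auto simp: diag off algebra_simps)
    also have "\<dots> = q i"
      using i fin by (simp add: sum.distrib q sc flip: sum_distrib_left)
    finally show ?thesis .
  qed
  have XY: "inner X Y = (\<Sum>i\<in>I. c i * q i)" by (simp add: Y_def inner_sum_right q_def)
  have YY: "inner Y Y = (\<Sum>i\<in>I. c i * q i)"
    by (subst (2) Y_def) (simp add: inner_sum_right VY)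
  have "0 \<le> inner (X - Y) (X - Y)" by simp
  also have "\<dots> = inner X X - (\<Sum>i\<in>I. c i * q i)"
    by (simp add: inner_diff_left inner_diff_right inner_commute XY YY)
  finally have "(1 - \<beta>) * (\<Sum>i\<in>I. c i * q i) \<le> (1 - \<beta>) * inner X X"
    using \<beta> by (intro mult_left_mono) auto
  moreover have "(1 - \<beta>) * (\<Sum>i\<in>I. c i * q i) = (\<Sum>i\<in>I. (q i)\<^sup>2 - \<beta> * C * q i)"
  proof -
    have "(1 - \<beta>) * (c i * q i) = (q i - \<beta> * C) * q i" for i
      using \<beta> by (simp add: c_def)
    then show ?thesis
      by (simp add: sum_distrib_left power2_eq_square left_diff_distrib)
  qed
  moreover have "\<dots> = (\<Sum>i\<in>I. (q i)\<^sup>2) - \<beta> * C * (D * C)"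
    by (simp add: sum_subtractf Q flip: sum_distrib_left)
  moreover have "\<beta> * C * (D * C) = \<beta> / D * (\<Sum>i\<in>I. q i)\<^sup>2"
    using D by (simp add: Q power2_eq_square)
  ultimately show ?thesis unfolding D_def q_def by simp
qed

section \<open>A top eigenvector\<close>

text \<open>
The maximizer \<open>x\<close> of the quadratic form on the sphere is an eigenvector: the form
\<open>\<mu> (y \<bullet> w) - \<Sum>i. (y \<bullet> v i) (w \<bullet> v i)\<close> is positive semidefinite and vanishes on \<open>(x, x)\<close>, hence on
\<open>(x, w)\<close> for all \<open>w\<close>.
\<close>

lemma top_direction:
  fixes v :: "'i \<Rightarrow> 'a::euclidean_space"
  obtains x \<mu> where "norm x = 1" "\<And>w. (\<Sum>i\<in>I. (inner w (v i))\<^sup>2) \<le> \<mu> * inner w w"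
    "\<And>w. (\<Sum>i\<in>I. inner x (v i) * inner w (v i)) = \<mu> * inner x w"
proof -
  define Q where "Q = (\<lambda>w. \<Sum>i\<in>I. (inner w (v i))\<^sup>2)"
  obtain b :: 'a where "b \<in> Basis" by (meson nonempty_Basis ex_in_conv)
  then have "sphere (0::'a) 1 \<noteq> {}" using norm_Basis by force
  moreover have "continuous_on (sphere 0 1) Q"
    unfolding Q_def by (intro continuous_intros)
  ultimately have "\<exists>x\<in>sphere 0 1. \<forall>y\<in>sphere 0 1. Q y \<le> Q x"
    by (intro continuous_attains_sup compact_sphere)
  then obtain x where "x \<in> sphere 0 1" "\<forall>y\<in>sphere 0 1. Q y \<le> Q x" ..
  then have x: "norm x = 1" and mx: "\<And>y. norm y = 1 \<Longrightarrow> Q y \<le> Q x" by auto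
  define \<mu> where "\<mu> = Q x"
  have le: "Q w \<le> \<mu> * inner w w" for w
  proof (cases "w = 0")
    case False
    have "Q w = (norm w)\<^sup>2 * Q (w /\<^sub>R norm w)"
      using False by (simp add: Q_def sum_distrib_left power_mult_distrib power_inverse mult.assoc[symmetric])
    also have "\<dots> \<le> (norm w)\<^sup>2 * \<mu>"
      using False unfolding \<mu>_def by (intro mult_left_mono mx) auto
    finally show ?thesis by (simp add: power2_norm_eq_inner mult.commute)
  qed (simp add: Q_def)
  have eig: "(\<Sum>i\<in>I. inner x (v i) * inner w (v i)) = \<mu> * inner x w" for w
  proof (rule ccontr)
    define b where "b = \<mu> * inner x w - (\<Sum>i\<in>I. inner x (v i) * inner w (v i))"
    define c where "c = \<mu> * inner w w - Q w"
    assume "\<not> ?thesis"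
    then have b: "b \<noteq> 0" by (simp add: b_def)
    have c: "c \<ge> 0" using le[of w] by (simp add: c_def)
    have xx: "inner x x = 1" using x by (simp add: dot_square_norm)
    have nonneg: "0 \<le> 2 * t * b + t\<^sup>2 * c" for t
    proof -
      have "Q (x + t *\<^sub>R w) = \<mu> + 2 * t * (\<Sum>i\<in>I. inner x (v i) * inner w (v i)) + t\<^sup>2 * Q w"
        by (simp add: \<mu>_def Q_def inner_add_left sum_distrib_left power2_eq_square
            algebra_simps sum.distrib)
      moreover have "inner (x + t *\<^sub>R w) (x + t *\<^sub>R w) = 1 + 2 * t * inner x w + t\<^sup>2 * inner w w"
        by (simp add: inner_add_left inner_add_right xx inner_commute power2_eq_square)
      ultimately show ?thesis using le[of "x + t *\<^sub>R w"]
        by (simp add: b_def c_def algebra_simps)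
    qed
    define t where "t = - b / (c + 1)"
    have b_t: "b = - t * (c + 1)" using c by (simp add: t_def)
    have "2 * t * b + t\<^sup>2 * c = - (t\<^sup>2 * (c + 2))"
      unfolding b_t by (simp add: power2_eq_square algebra_simps)
    moreover have "t\<^sup>2 * (c + 2) > 0" using b b_t c by (intro mult_pos_pos) auto
    ultimately show False using nonneg[of t] by linarith
  qed
  from that[OF x le[unfolded Q_def] eig] show thesis .
qed

section \<open>The spectral inequality\<close>

locale equiangular_vectors =
  fixes I :: "'i set" and v :: "'i \<Rightarrow> real ^ 'n::finite" and \<alpha> :: real
  assumes fin: "finite I" and \<alpha>: "0 < \<alpha>" "\<alpha> < 1"
    and unit: "\<And>i. i \<in> I \<Longrightarrow> inner (v i) (v i) = 1"
    and abs_inner: "\<And>i j. i \<in> I \<Longrightarrow> j \<in> I \<Longrightarrow> i \<noteq> j \<Longrightarrow> \<bar>inner (v i) (v j)\<bar> = \<alpha>"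
begin

text \<open>The mean of \<open>\<mu>\<^sup>2\<close> over the eigenvalues \<open>\<mu>\<close> of the Gram matrix.\<close>

definition "D = 1 - \<alpha>\<^sup>2 + \<alpha>\<^sup>2 * card I"

text \<open>The threshold that \<open>D\<close> must exceed for the top eigenvector to be forced to be flat.\<close>

definition "s = (1 - \<alpha>\<^sup>2) / (2 * \<alpha>\<^sup>2)"

lemma \<alpha>2: "0 < \<alpha>\<^sup>2" "\<alpha>\<^sup>2 < 1"
  using \<alpha> by (simp_all add: power_less_one_iff)

lemma s: "2 * \<alpha>\<^sup>2 * s = 1 - \<alpha>\<^sup>2" "0 < s"
  using \<alpha> \<alpha>2 by (simp_all add: s_def)

lemma D_pos: "0 < D"
  unfolding D_def using \<alpha>2 by (intro add_pos_nonneg) auto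

lemma inner_sq: "i \<in> I \<Longrightarrow> j \<in> I \<Longrightarrow> i \<noteq> j \<Longrightarrow> (inner (v i) (v j))\<^sup>2 = \<alpha>\<^sup>2"
  using abs_inner[of i j] by (metis power2_abs)

text \<open>
Bessel's inequality for the symmetrized product of \<open>a\<close> and \<open>b\<close> against the projections to the lines,
whose pairwise inner products are \<open>\<alpha>\<^sup>2\<close> whatever the signs of the inner products of the \<open>v i\<close>.
\<close>

lemma quartic_bessel:
  "2 * (\<Sum>i\<in>I. (inner a (v i))\<^sup>2 * (inner b (v i))\<^sup>2)
      - 2 * \<alpha>\<^sup>2 / D * (\<Sum>i\<in>I. inner a (v i) * inner b (v i))\<^sup>2
     \<le> (1 - \<alpha>\<^sup>2) * (inner a a * inner b b + (inner a b)\<^sup>2)"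
proof -
  have "(\<Sum>i\<in>I. (inner (sym_outer a b) (sym_outer (v i) (v i)))\<^sup>2)
      - \<alpha>\<^sup>2 / D * (\<Sum>i\<in>I. inner (sym_outer a b) (sym_outer (v i) (v i)))\<^sup>2
     \<le> (1 - \<alpha>\<^sup>2) * inner (sym_outer a b) (sym_outer a b)"
    unfolding D_def using fin \<alpha>2
    by (intro bessel_equal_inner) (auto simp: inner_sym_outer unit inner_sq simp flip: power2_eq_square)
  moreover have "inner (sym_outer a b) (sym_outer (v i) (v i)) = inner a (v i) * inner b (v i)" for i
    by (simp add: inner_sym_outer)
  moreover have "inner (sym_outer a b) (sym_outer a b) = (inner a a * inner b b + (inner a b)\<^sup>2) / 2"
    by (simp add: inner_sym_outer inner_commute power2_eq_square)
  ultimately have "(\<Sum>i\<in>I. (inner a (v i))\<^sup>2 * (inner b (v i))\<^sup>2)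
      - \<alpha>\<^sup>2 / D * (\<Sum>i\<in>I. inner a (v i) * inner b (v i))\<^sup>2
     \<le> (1 - \<alpha>\<^sup>2) * (inner a a * inner b b + (inner a b)\<^sup>2) / 2"
    by (simp only: power_mult_distrib times_divide_eq_right)
  then show ?thesis by linarith
qed

lemma sum_inner_sq_mult:
  assumes l: "l \<in> I"
  shows "(\<Sum>i\<in>I. f i * (inner (v l) (v i))\<^sup>2) = \<alpha>\<^sup>2 * (\<Sum>i\<in>I. f i) + (1 - \<alpha>\<^sup>2) * f l"
proof -
  have "(\<Sum>i\<in>I. f i * (inner (v l) (v i))\<^sup>2)
      = (\<Sum>i\<in>I. \<alpha>\<^sup>2 * f i + (if i = l then (1 - \<alpha>\<^sup>2) * f l else 0))"
    using l by (intro sum.cong) (auto simp: unit inner_sq algebra_simps)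
  then show ?thesis using l fin by (simp add: sum.distrib sum_distrib_left)
qed

text \<open>
After division by \<open>D (\<mu> - s)\<close> the left-hand side is the trace of \<open>\<Sum>i. v i (v i)\<^sup>T\<close> on the complement of the top
eigenvector, and the right-hand side is \<open>n - 1\<close> times a bound on the Rayleigh quotient there.
\<close>

theorem spectral_inequality:
  assumes ne: "I \<noteq> {}" and sD: "s < D"
  obtains \<mu> :: real where "D \<le> \<mu>" "\<mu> \<le> 1 + \<alpha> * (real (card I) - 1)"
    "D * (\<mu> - s) * (real (card I) - \<mu>) \<le> \<alpha>\<^sup>2 * s * (real CARD('n) - 1) * (\<mu>\<^sup>2 - s * D)"
proof -
  obtain x \<mu> where x: "norm x = 1"
    and top: "\<And>w. (\<Sum>i\<in>I. (inner w (v i))\<^sup>2) \<le> \<mu> * inner w w"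
    and eig: "\<And>w. (\<Sum>i\<in>I. inner x (v i) * inner w (v i)) = \<mu> * inner x w"
    by (rule top_direction[where I = I and v = v]) (rule that)
  have xx: "inner x x = 1" using x by (simp add: dot_square_norm)
  define N where "N = real (card I)"
  have N: "N > 0" using ne fin by (simp add: N_def card_gt_0_iff)
  define g where "g = (\<lambda>i. inner x (v i))"
  have g2: "(\<Sum>i\<in>I. (g i)\<^sup>2) = \<mu>" using eig[of x] xx by (simp add: g_def power2_eq_square)
  have lower: "D \<le> \<mu>"
  proof -
    \<comment> \<open>\<open>N D\<close> is the sum of the squared entries of the Gram matrix.\<close>
    have "N * D = (\<Sum>l\<in>I. \<Sum>i\<in>I. 1 * (inner (v l) (v i))\<^sup>2)"
      by (subst sum.cong[OF refl sum_inner_sq_mult]) (simp_all add: N_def D_def)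
    also have "\<dots> \<le> (\<Sum>l\<in>I. \<mu> * inner (v l) (v l))"
      by (intro sum_mono) (use top in simp)
    also have "\<dots> = N * \<mu>" by (simp add: unit N_def)
    finally show ?thesis using N by simp
  qed
  have \<mu>: "\<mu> > 0" "\<mu> > s" using lower D_pos sD by auto
  have upper: "\<mu> \<le> 1 + \<alpha> * (N - 1)"
  proof -
    have "\<mu> * \<mu> = (\<Sum>i\<in>I. g i * (\<mu> * g i))"
      by (simp add: g2[symmetric] sum_distrib_left power2_eq_square mult_ac)
    also have "\<dots> = (\<Sum>i\<in>I. \<Sum>j\<in>I. g i * g j * inner (v i) (v j))"
      by (simp add: g_def eig[symmetric] sum_distrib_left mult_ac)
    also have "\<dots> \<le> (\<Sum>i\<in>I. \<Sum>j\<in>I. \<alpha> * (\<bar>g i\<bar> * \<bar>g j\<bar>) + (if j = i then (1 - \<alpha>) * (g i)\<^sup>2 else 0))"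
    proof (intro sum_mono)
      fix i j assume ij: "i \<in> I" "j \<in> I"
      show "g i * g j * inner (v i) (v j)
          \<le> \<alpha> * (\<bar>g i\<bar> * \<bar>g j\<bar>) + (if j = i then (1 - \<alpha>) * (g i)\<^sup>2 else 0)"
      proof (cases "i = j")
        case False
        have "g i * g j * inner (v i) (v j) \<le> \<bar>g i * g j * inner (v i) (v j)\<bar>" by simp
        also have "\<dots> = \<alpha> * (\<bar>g i\<bar> * \<bar>g j\<bar>)" using abs_inner ij False by (simp add: abs_mult)
        finally show ?thesis using False by simp
      qed (use ij in \<open>simp add: unit power2_eq_square algebra_simps\<close>)
    qed
    also have "\<dots> = \<alpha> * (\<Sum>i\<in>I. \<bar>g i\<bar>)\<^sup>2 + (1 - \<alpha>) * \<mu>"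
      using fin by (simp add: sum.distrib power2_eq_square sum_product g2[symmetric]
          sum_distrib_left mult_ac)
    also have "\<dots> \<le> \<alpha> * (N * \<mu>) + (1 - \<alpha>) * \<mu>"
      using \<alpha> sum_squared_le_sum_of_squares[where f = "\<lambda>i. \<bar>g i\<bar>" and I = I]
      by (intro add_mono mult_left_mono) (simp_all add: g2 N_def mult.commute)
    also have "\<dots> = \<mu> * (1 + \<alpha> * (N - 1))" by (simp add: algebra_simps)
    finally show ?thesis using \<mu> by simp
  qed
  \<comment> \<open>In \<open>quartic_bessel\<close> for \<open>x\<close> and \<open>v l\<close>, the first sum is known by equiangularity and the
    second by the eigenvector equation.\<close>
  have flat: "\<mu> - s \<le> (g l)\<^sup>2 * (\<mu>\<^sup>2 / D - s)" if l: "l \<in> I" for l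
  proof -
    have "2 * (\<Sum>i\<in>I. (g i)\<^sup>2 * (inner (v l) (v i))\<^sup>2) - 2 * \<alpha>\<^sup>2 / D * (\<mu> * g l)\<^sup>2
        \<le> (1 - \<alpha>\<^sup>2) * (1 + (g l)\<^sup>2)"
      using quartic_bessel[of x "v l"] l by (simp add: eig g_def xx unit)
    then have "2 * (\<alpha>\<^sup>2 * \<mu> + (1 - \<alpha>\<^sup>2) * (g l)\<^sup>2) - 2 * \<alpha>\<^sup>2 / D * (\<mu> * g l)\<^sup>2
        \<le> (1 - \<alpha>\<^sup>2) * (1 + (g l)\<^sup>2)"
      by (simp only: sum_inner_sq_mult[OF l] g2)
    then have "(2 * \<alpha>\<^sup>2) * (\<mu> - s) \<le> (2 * \<alpha>\<^sup>2) * ((g l)\<^sup>2 * (\<mu>\<^sup>2 / D - s))"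
      unfolding s(1)[symmetric] by (simp add: algebra_simps power_mult_distrib)
    then show ?thesis using \<alpha>2 by (simp only: mult_le_cancel_left_pos)
  qed
  have pos: "\<mu>\<^sup>2 / D - s > 0"
  proof -
    have "\<mu> * D \<le> \<mu>\<^sup>2" using lower \<mu> by (simp add: power2_eq_square)
    then have "\<mu> \<le> \<mu>\<^sup>2 / D" using D_pos by (simp add: field_simps)
    then show ?thesis using \<mu> by linarith
  qed
  \<comment> \<open>For \<open>w\<close> orthogonal to \<open>x\<close> the subtracted square in \<open>quartic_bessel\<close> vanishes, and \<open>flat\<close>
    bounds the weights \<open>(g i)\<^sup>2\<close> in the remaining sum from below.\<close>
  have orth: "(\<mu> - s) * (\<Sum>i\<in>I. (inner w (v i))\<^sup>2) \<le> \<alpha>\<^sup>2 * s * (\<mu>\<^sup>2 / D - s) * inner w w"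
    if w: "inner x w = 0" for w
  proof -
    have "(\<mu> - s) * (\<Sum>i\<in>I. (inner w (v i))\<^sup>2)
        \<le> (\<Sum>i\<in>I. (g i)\<^sup>2 * (\<mu>\<^sup>2 / D - s) * (inner w (v i))\<^sup>2)"
      unfolding sum_distrib_left by (intro sum_mono mult_right_mono flat) auto
    also have "\<dots> = (\<mu>\<^sup>2 / D - s) * (\<Sum>i\<in>I. (g i)\<^sup>2 * (inner w (v i))\<^sup>2)"
      by (simp add: sum_distrib_left mult_ac)
    also have "\<dots> \<le> (\<mu>\<^sup>2 / D - s) * (\<alpha>\<^sup>2 * s * inner w w)"
    proof (intro mult_left_mono)
      have "2 * (\<Sum>i\<in>I. (g i)\<^sup>2 * (inner w (v i))\<^sup>2) \<le> (2 * \<alpha>\<^sup>2 * s) * inner w w"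
        using quartic_bessel[of x w] w by (simp add: eig g_def xx s(1))
      then show "(\<Sum>i\<in>I. (g i)\<^sup>2 * (inner w (v i))\<^sup>2) \<le> \<alpha>\<^sup>2 * s * inner w w" by simp
    qed (use pos in simp)
    finally show ?thesis by (simp add: mult_ac)
  qed
  \<comment> \<open>Projecting the standard basis to the complement of \<open>x\<close> computes the trace there
    without an orthonormal basis that contains \<open>x\<close>.\<close>
  define p where "p = (\<lambda>e. e - inner x e *\<^sub>R x)"
  have "(\<mu> - s) * (N - \<mu>) = (\<mu> - s) * (\<Sum>e\<in>Basis. \<Sum>i\<in>I. (inner (p e) (v i))\<^sup>2)"
  proof -
    have "(\<Sum>i\<in>I. (inner (p e) (v i))\<^sup>2) = (\<Sum>i\<in>I. (inner e (v i))\<^sup>2) - \<mu> * (inner x e)\<^sup>2" for e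
    proof -
      have "(\<Sum>i\<in>I. (inner (p e) (v i))\<^sup>2)
          = (\<Sum>i\<in>I. (inner e (v i))\<^sup>2) - 2 * inner x e * (\<Sum>i\<in>I. g i * inner e (v i))
            + (inner x e)\<^sup>2 * (\<Sum>i\<in>I. (g i)\<^sup>2)"
        by (simp add: p_def g_def inner_diff_left power2_eq_square algebra_simps
            sum.distrib sum_subtractf sum_distrib_left)
      also have "(\<Sum>i\<in>I. g i * inner e (v i)) = \<mu> * inner x e" by (simp add: g_def eig)
      finally show ?thesis unfolding g2 by (simp add: power2_eq_square)
    qed
    moreover have "(\<Sum>e\<in>Basis. \<Sum>i\<in>I. (inner e (v i))\<^sup>2) = N"
    proof -
      have "(\<Sum>e\<in>Basis. \<Sum>i\<in>I. (inner e (v i))\<^sup>2) = (\<Sum>i\<in>I. \<Sum>e\<in>Basis. (inner (v i) e)\<^sup>2)"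
        by (subst sum.swap) (simp add: inner_commute)
      also have "\<dots> = (\<Sum>i\<in>I. inner (v i) (v i))"
        by (simp add: euclidean_inner[of "v i" "v i" for i] power2_eq_square)
      finally show ?thesis by (simp add: unit N_def)
    qed
    moreover have "(\<Sum>e\<in>Basis. (inner x e)\<^sup>2) = 1"
      using euclidean_inner[of x x] xx by (simp add: power2_eq_square)
    ultimately show ?thesis by (simp add: sum_subtractf flip: sum_distrib_left)
  qed
  also have "\<dots> \<le> (\<Sum>e\<in>Basis. \<alpha>\<^sup>2 * s * (\<mu>\<^sup>2 / D - s) * inner (p e) (p e))"
    by (subst sum_distrib_left, intro sum_mono orth) (simp add: p_def inner_diff_right xx)
  also have "\<dots> = \<alpha>\<^sup>2 * s * (\<mu>\<^sup>2 / D - s) * (real CARD('n) - 1)"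
  proof -
    have "inner (p e) (p e) = 1 - (inner x e)\<^sup>2" if "e \<in> Basis" for e
      using that by (simp add: p_def inner_diff_left inner_diff_right xx inner_commute power2_eq_square)
    moreover have "(\<Sum>e\<in>Basis. (inner x e)\<^sup>2) = 1"
      using euclidean_inner[of x x] xx by (simp add: power2_eq_square)
    ultimately show ?thesis by (simp add: sum_subtractf flip: sum_distrib_left)
  qed
  finally have "D * ((\<mu> - s) * (N - \<mu>)) \<le> D * (\<alpha>\<^sup>2 * s * (\<mu>\<^sup>2 / D - s) * (real CARD('n) - 1))"
    using D_pos by (intro mult_left_mono) auto
  also have "\<dots> = \<alpha>\<^sup>2 * s * (real CARD('n) - 1) * (D * (\<mu>\<^sup>2 / D - s))" by (simp only: mult_ac)
  also have "D * (\<mu>\<^sup>2 / D - s) = \<mu>\<^sup>2 - s * D" using D_pos by (simp add: algebra_simps)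
  finally show thesis using that[OF lower] upper unfolding N_def by (simp add: mult.assoc)
qed

end

section \<open>Eliminating the top eigenvalue\<close>

text \<open>
Here \<open>m = N - 1\<close>, \<open>a = 1 / \<alpha>\<close> and \<open>p = n - 1\<close>. Replacing \<open>p\<close> by its upper bound \<open>q\<close>, the left-hand side of
\<open>main\<close> minus the right-hand side is a concave quadratic \<open>h\<close> in \<open>\<mu>\<close>. It is positive at the lower end \<open>D\<close>,
and \<open>a\<^sup>4 h\<close> at the upper end \<open>U = 1 + m / a\<close> is \<open>a - 1\<close> times the expression in the conclusion; were that
expression positive, \<open>h\<close> would be positive at \<open>\<mu>\<close>, against \<open>main\<close>.
\<close>

lemma spectral_inequality_at_endpoint:
  fixes D s \<mu> m a p e :: real
  assumes a: "a > 1" and s: "s = (a\<^sup>2 - 1) / 2" and D: "D = 1 + m / a\<^sup>2" and m: "m > 0"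
    and sD: "s < D" and \<mu>: "D \<le> \<mu>" "\<mu> \<le> 1 + m / a"
    and p: "0 \<le> p" "(a + 1) / 2 * p \<le> m - e" and e: "0 \<le> e"
    and main: "D * (\<mu> - s) * (m + 1 - \<mu>) \<le> s / a\<^sup>2 * p * (\<mu>\<^sup>2 - s * D)"
  shows "(e - (a - 1) * (s - a)) * m\<^sup>2 - (a\<^sup>2 * (a - 1) * (s - 1) + e * (s - 2 * a)) * m
            - e * a\<^sup>2 * (s - 1) \<le> 0"
proof (rule ccontr)
  assume neg: "\<not> ?thesis"
  define U where "U = 1 + m / a"
  define q where "q = 2 * (m - e) / (a + 1)"
  define h where "h = (\<lambda>x. D * (x - s) * (m + 1 - x) - s / a\<^sup>2 * q * (x\<^sup>2 - s * D))"
  have a2: "a\<^sup>2 > 1" using a by (simp add: power2_eq_square less_1_mult)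
  have s0: "s > 0" using a2 s by simp
  have D1: "D > 1" using a m by (simp add: D)
  have q: "p \<le> q" "0 \<le> q" "q \<le> m"
  proof -
    show "p \<le> q" using p a by (simp add: q_def field_simps)
    then show "0 \<le> q" using p by simp
    have "2 * (m - e) \<le> (a + 1) * m" 
    proof -
      have "1 * m \<le> a * m" using a m by (intro mult_right_mono) auto
      then show ?thesis using e by (simp add: algebra_simps)
    qed
    then show "q \<le> m" using a by (simp add: q_def field_simps)
  qed
  have UD: "D < U"
  proof -
    have "m / a\<^sup>2 < m / a" using a m by (simp add: field_simps power2_eq_square)
    then show ?thesis by (simp add: D U_def)
  qed
  have "h D > 0"
  proof -
    have "s / a\<^sup>2 * q \<le> s / a\<^sup>2 * m" using q s0 by (intro mult_left_mono) auto
    also have "\<dots> < 2 * (s / a\<^sup>2 * m)"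
    proof -
      have "0 < s / a\<^sup>2 * m" using s0 m a by (intro mult_pos_pos) auto
      then show ?thesis unfolding mult_2 by (simp only: less_add_same_cancel1)
    qed
    also have "\<dots> = m + 1 - D" using a by (simp add: s D field_simps)
    finally have "0 < D * (D - s) * (m + 1 - D - s / a\<^sup>2 * q)"
      using D1 sD by (intro mult_pos_pos) auto
    also have "\<dots> = h D" by (simp add: h_def algebra_simps power2_eq_square)
    finally show ?thesis .
  qed
  moreover have "h U > 0"
  proof -
    have "a ^ 4 * h U = (a\<^sup>2 * D) * (a * (U - s)) * (a * (m + 1 - U))
        - s * q * ((a * U)\<^sup>2 - s * (a\<^sup>2 * D))"
      using a by (simp add: h_def field_simps power2_eq_square power4_eq_xxxx)
    also have "s * q = (a - 1) * (m - e)"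
      using a by (simp add: q_def s field_simps power2_eq_square)
    also have "a\<^sup>2 * D = a\<^sup>2 + m" using a by (simp add: D field_simps)
    also have "a * (U - s) = a + m - a * s" using a by (simp add: U_def field_simps)
    also have "a * (m + 1 - U) = (a - 1) * m" using a by (simp add: U_def field_simps)
    also have "a * U = a + m" using a by (simp add: U_def field_simps)
    also have "(a\<^sup>2 + m) * (a + m - a * s) * ((a - 1) * m)
          - (a - 1) * (m - e) * ((a + m)\<^sup>2 - s * (a\<^sup>2 + m))
        = (a - 1) * ((e - (a - 1) * (s - a)) * m\<^sup>2
            - (a\<^sup>2 * (a - 1) * (s - 1) + e * (s - 2 * a)) * m - e * a\<^sup>2 * (s - 1))"
      by algebra
    also have "\<dots> > 0" using a neg by (intro mult_pos_pos) auto
    finally show ?thesis using a by (simp add: zero_less_mult_iff)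
  qed
  \<comment> \<open>Concavity: the last summand is the excess of \<open>h\<close> over its chord from \<open>D\<close> to \<open>U\<close>.\<close>
  moreover have "(U - D) * h \<mu> = (U - \<mu>) * h D + (\<mu> - D) * h U
      + (D + s / a\<^sup>2 * q) * (\<mu> - D) * (U - \<mu>) * (U - D)"
    unfolding h_def by algebra
  moreover have "0 \<le> (D + s / a\<^sup>2 * q) * (\<mu> - D) * (U - \<mu>) * (U - D)"
    using D1 s0 q \<mu> UD by (intro mult_nonneg_nonneg add_nonneg_nonneg) (auto simp: U_def)
  moreover have "(U - \<mu>) * h D + (\<mu> - D) * h U > 0"
  proof (cases "\<mu> = D")
    case True
    then show ?thesis using \<open>h D > 0\<close> UD by simp
  next
    case False
    then show ?thesis using \<open>h D > 0\<close> \<open>h U > 0\<close> \<mu>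
      by (intro add_nonneg_pos mult_nonneg_nonneg mult_pos_pos) (auto simp: U_def)
  qed
  ultimately have "(U - D) * h \<mu> > 0" by linarith
  then have "h \<mu> > 0" using UD by (simp add: zero_less_mult_iff)
  moreover have "s / a\<^sup>2 * p * (\<mu>\<^sup>2 - s * D) \<le> s / a\<^sup>2 * q * (\<mu>\<^sup>2 - s * D)"
  proof -
    have "s * D \<le> \<mu> * \<mu>" using sD \<mu> D1 s0 by (intro mult_mono) auto
    then show ?thesis using q s0
      by (intro mult_right_mono mult_left_mono) (auto simp: power2_eq_square)
  qed
  ultimately show False using main by (simp add: h_def)
qed

lemma equiangular_card_quadratic:
  fixes S :: "(real ^ 'n::finite) set set" and a e :: real
  assumes S: "equiangular (1 / a) S" and a: "a > 1" and e: "0 \<le> e"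
    and big: "real (card S) > (a\<^sup>2 - 1) * (a\<^sup>2 - 2) / 2" "card S > 1"
    and n: "(a + 1) / 2 * (real CARD('n) - 1) \<le> real (card S) - 1 - e"
  shows "(e - (a - 1) * ((a\<^sup>2 - 1) / 2 - a)) * (real (card S) - 1)\<^sup>2
      - (a\<^sup>2 * (a - 1) * ((a\<^sup>2 - 1) / 2 - 1) + e * ((a\<^sup>2 - 1) / 2 - 2 * a)) * (real (card S) - 1)
            - e * a\<^sup>2 * ((a\<^sup>2 - 1) / 2 - 1) \<le> 0"
proof -
  define N where "N = real (card S)"
  define m where "m = N - 1"
  define s where "s = (a\<^sup>2 - 1) / 2"
  define D where "D = 1 + m / a\<^sup>2"
  have a': "0 < 1 / a" "1 / a < 1" using a by auto
  obtain u where u: "\<And>L. L \<in> S \<Longrightarrow> norm (u L) = 1" "\<And>L. L \<in> S \<Longrightarrow> span {u L} = L"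
    "\<And>L M. L \<in> S \<Longrightarrow> M \<in> S \<Longrightarrow> L \<noteq> M \<Longrightarrow> \<bar>inner (u L) (u M)\<bar> = 1 / a"
    by (rule equiangular_units[OF S a']) (rule that)
  interpret E: equiangular_vectors S u "1 / a"
    using equiangular_bound(1)[OF S a'] a' u by unfold_locales (auto simp: dot_square_norm)
  have sE: "E.s = s" using a by (simp add: E.s_def s_def field_simps)
  have DE: "E.D = D" using a by (simp add: E.D_def D_def m_def N_def field_simps)
  have sD: "s < D"
  proof -
    have "a\<^sup>2 * s = (a\<^sup>2 - 1) * (a\<^sup>2 - 2) / 2 + a\<^sup>2 - 1" by (simp add: s_def field_simps)
    also have "\<dots> < a\<^sup>2 + m" using big by (simp add: m_def N_def)
    also have "\<dots> = a\<^sup>2 * D" using a by (simp add: D_def field_simps)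
    finally show ?thesis using a by simp
  qed
  obtain \<mu> where \<mu>: "D \<le> \<mu>" "\<mu> \<le> 1 + m / a"
    "D * (\<mu> - s) * (N - \<mu>) \<le> (1 / a)\<^sup>2 * s * (real CARD('n) - 1) * (\<mu>\<^sup>2 - s * D)"
    using E.spectral_inequality sD big a unfolding sE DE m_def N_def by (force simp: field_simps)
  have "(e - (a - 1) * (s - a)) * m\<^sup>2 - (a\<^sup>2 * (a - 1) * (s - 1) + e * (s - 2 * a)) * m
            - e * a\<^sup>2 * (s - 1) \<le> 0"
    using a e big(2) sD \<mu> n
    by (intro spectral_inequality_at_endpoint[of a s D m \<mu> "real CARD('n) - 1"])
      (simp_all add: s_def D_def m_def N_def power_divide mult.commute)
  then show ?thesis unfolding m_def N_def s_def .
qed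

section \<open>The linear bounds\<close>

text \<open>
Lines in number at most \<open>g + 1\<close> satisfy the bound by the assumption \<open>n\<close>. Beyond that the previous lemma applies
with \<open>m > g\<close>, and the conditions at \<open>g\<close> make the quadratic \<open>(A m - B) m - C\<close> positive from \<open>g\<close> on.
\<close>

lemma max_lines_linear_bound:
  fixes a e A B C g :: real and k c :: nat
  assumes a: "a > 1" "a = 2 * real k - 1" and e: "e = real (c + k)"
    and A: "A = e - (a - 1) * ((a\<^sup>2 - 1) / 2 - a)"
    and B: "B = a\<^sup>2 * (a - 1) * ((a\<^sup>2 - 1) / 2 - 1) + e * ((a\<^sup>2 - 1) / 2 - 2 * a)"
    and C: "C = e * a\<^sup>2 * ((a\<^sup>2 - 1) / 2 - 1)"
    and g: "g = (a\<^sup>2 - 1) * (a\<^sup>2 - 2) / 2 - 1"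
    and at_g: "0 < A" "0 < g" "B \<le> A * g" "C \<le> (A * g - B) * g"
    and n: "g + 1 \<le> c + k * real CARD('n::finite)"
  shows "real (max_lines (1 / a) TYPE('n)) \<le> c + k * real CARD('n)"
proof (rule ccontr)
  assume "\<not> ?thesis"
  moreover obtain S :: "(real ^ 'n) set set"
    where S: "equiangular (1 / a) S" "card S = max_lines (1 / a) TYPE('n)"
    using max_lines_greatest(1)[of "1 / a"] a by auto
  ultimately have gt: "real (card S) > c + k * real CARD('n)" by simp
  then have "real (card S) > real (c + k * CARD('n))" by simp
  \<comment> \<open>The excess over \<open>c + k n\<close> is an integer, hence at least 1. Without this unit, \<open>e\<close> would be
    \<open>c + k - 1\<close>, and the quadratic would be negative for 292 lines at \<open>a = 5\<close>, \<open>n = 87\<close>.\<close>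
  then have N: "real (card S) \<ge> c + k * real CARD('n) + 1"
    unfolding of_nat_less_iff by (simp flip: of_nat_mult of_nat_add of_nat_Suc)
  define m where "m = real (card S) - 1"
  have m: "m > g" using gt n by (simp add: m_def)
  have "(A * g - B) * g < (A * m - B) * m"
  proof -
    have "A * g < A * m" using at_g m by simp
    then have "(A * g - B) * g \<le> (A * g - B) * m" "(A * g - B) * m < (A * m - B) * m"
      using at_g m by (auto intro!: mult_left_mono mult_strict_right_mono)
    then show ?thesis by linarith
  qed
  then have "A * m\<^sup>2 - B * m - C > 0"
    using at_g by (simp add: power2_eq_square algebra_simps)
  moreover have "A * m\<^sup>2 - B * m - C \<le> 0"
    unfolding A B C m_def
  proof (rule equiangular_card_quadratic[OF S(1) a(1)])
    show "0 \<le> e" by (simp add: e)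
    show "(a\<^sup>2 - 1) * (a\<^sup>2 - 2) / 2 < real (card S)" using gt n by (simp add: g)
    have "real (card S) > 1" using m at_g by (simp add: m_def)
    then show "card S > 1" by simp
    have "real k * (real CARD('n) - 1) \<le> real (card S) - 1 - e"
      using N by (simp add: e algebra_simps)
    then show "(a + 1) / 2 * (real CARD('n) - 1) \<le> real (card S) - 1 - e"
      using a by simp
  qed
  ultimately show False by simp
qed

theorem mainTheorem2:
  fixes \<alpha> c :: real and n\<^sub>0 :: nat
  assumes "(\<alpha>, c, n\<^sub>0) \<in> {(1/3, 4, 13), (1/5, 30, 87), (1/7, 116, 261),
                           (1/9, 316, 166018), (1/11, 699, 751307)}"
    and "CARD('n::finite) \<ge> n\<^sub>0"
  shows "real (max_lines \<alpha> TYPE('n)) \<le> c + (1 + \<alpha>) / (2 * \<alpha>) * real CARD('n)"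
proof -
  note bound = max_lines_linear_bound[OF _ _ refl refl refl refl refl, where 'n = 'n]
  consider "\<alpha> = 1 / 3" "c = 4" "n\<^sub>0 = 13" | "\<alpha> = 1 / 5" "c = 30" "n\<^sub>0 = 87"
    | "\<alpha> = 1 / 7" "c = 116" "n\<^sub>0 = 261" | "\<alpha> = 1 / 9" "c = 316" "n\<^sub>0 = 166018"
    | "\<alpha> = 1 / 11" "c = 699" "n\<^sub>0 = 751307"
    using assms(1) by auto
  then show ?thesis
  proof cases
    case 1
    have "real (max_lines (1 / 3) TYPE('n)) \<le> real 4 + real 2 * real CARD('n)"
      by (rule bound) (use assms(2) 1 in \<open>simp_all add: power2_eq_square\<close>)
    then show ?thesis unfolding 1 by simp
  next
    case 2
    have "real (max_lines (1 / 5) TYPE('n)) \<le> real 30 + real 3 * real CARD('n)"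
      by (rule bound) (use assms(2) 2 in \<open>simp_all add: power2_eq_square\<close>)
    then show ?thesis unfolding 2 by simp
  next
    case 3
    have "real (max_lines (1 / 7) TYPE('n)) \<le> real 116 + real 4 * real CARD('n)"
      by (rule bound) (use assms(2) 3 in \<open>simp_all add: power2_eq_square\<close>)
    then show ?thesis unfolding 3 by simp
  next
    case 4
    have "real (max_lines (1 / 9) TYPE('n)) \<le> real 316 + real 5 * real CARD('n)"
      by (rule bound) (use assms(2) 4 in \<open>simp_all add: power2_eq_square\<close>)
    then show ?thesis unfolding 4 by simp
  next
    case 5
    have "real (max_lines (1 / 11) TYPE('n)) \<le> real 699 + real 6 * real CARD('n)"
      by (rule bound) (use assms(2) 5 in \<open>simp_all add: power2_eq_square\<close>)
    then show ?thesis unfolding 5 by simp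
  qed
qed

end
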